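(* Let $(X,\Sigma,\mu)$ be a standard probability space, let $T\colon X\to X$ be an invertible measure-preserving transformation of $(X,\Sigma,\mu)$, and let $f\colon X\to\mathbb{R}$ be a $\mu$-measurable function (not assumed integrable). Define the ergodic maximal function $$T^\ast f(x)=\sup_{n\ge 1}\frac1n\left|\sum_{k=0}^{n-1} f(T^k x)\right| .$$ If $T^\ast f(x)<\infty$ for $\mu$-a.e. $x\in X$, then the limit $$\lim_{n\to\infty}\frac1n\sum_{k=0}^{n-1} f(T^k x)$$ exists for $\mu$-a.e. $x\in X$.
   Context: $T^k$ denotes the $k$-fold iterate of $T$, with $T^0$ the identity. The absolute value in the definition of $T^\ast f$ is taken outside the sum. An invertible measure-preserving transformation is a bijection $T$ of $X$ such that $T$ and $T^{-1}$ are measurable and $\mu(T^{-1}A)=\mu(A)$ for all $A\in\Sigma$. A standard probability space is a standard Borel space equipped with a probability measure. *)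

theory Defs
  imports "HOL-Probability.Probability"
begin

definition standard_borel_space :: "'a measure \<Rightarrow> bool" where
  "standard_borel_space M \<longleftrightarrow>
     (\<exists>S. topspace S = space M \<and> completely_metrizable_space S \<and> second_countable S \<and>
          sets M = sigma_sets (space M) {U. openin S U})"

definition standard_probability_space :: "'a measure \<Rightarrow> bool" where
  "standard_probability_space M \<longleftrightarrow> standard_borel_space M \<and> prob_space M"

text \<open>Only the restriction of \<open>T\<close> to \<open>space M\<close> matters.\<close>

definition invertible_measure_preserving :: "'a measure \<Rightarrow> ('a \<Rightarrow> 'a) \<Rightarrow> bool" where
  "invertible_measure_preserving M T \<longleftrightarrow>
     bij_betw T (space M) (space M) \<and>
     T \<in> M \<rightarrow>\<^sub>M M \<and>
     inv_into (space M) T \<in> M \<rightarrow>\<^sub>M M \<and>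
     (\<forall>A\<in>sets M. emeasure M (T -` A \<inter> space M) = emeasure M A)"

definition ergodic_average :: "('a \<Rightarrow> 'a) \<Rightarrow> ('a \<Rightarrow> real) \<Rightarrow> nat \<Rightarrow> 'a \<Rightarrow> real" where
  "ergodic_average T f n x = (1 / real n) * (\<Sum>k<n. f ((T ^^ k) x))"

definition ergodic_maximal :: "('a \<Rightarrow> 'a) \<Rightarrow> ('a \<Rightarrow> real) \<Rightarrow> 'a \<Rightarrow> ereal" where
  "ergodic_maximal T f x =
     (SUP n\<in>{1..}. ereal ((1 / real n) * \<bar>\<Sum>k<n. f ((T ^^ k) x)\<bar>))"

end

theory Submission
  imports Defs
begin

text \<open>
  Let \<open>A\<close> be a set on which \<open>T\<^sup>* f \<le> C\<close>, and for \<open>y\<close> in the forward orbit of \<open>A\<close> let \<open>p y\<close> be the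
  time since the last visit to \<open>A\<close> and \<open>u y\<close> the sum of \<open>f\<close> since that visit, so \<open>\<bar>u\<bar> \<le> C p\<close>. Then
  \<open>f = F + u \<circ> T - u\<close>, where \<open>F\<close> collects the whole sum over an excursion at the moment of return
  to \<open>A\<close>. For \<open>f = 1\<close> this reads \<open>1 = P + p \<circ> T - p\<close> with \<open>P\<close> integrable by Kac; as \<open>\<bar>F\<bar> \<le> C P\<close>,
  also \<open>F\<close> is integrable. Birkhoff's theorem for \<open>P\<close> shows that \<open>p (T\<^sup>n x) / n\<close> converges, and the limit
  is \<open>0\<close> because it is \<open>0\<close> in probability. Hence \<open>u (T\<^sup>n x) / n\<close> tends to \<open>0\<close> and Birkhoff's theorem
  for \<open>F\<close> gives convergence on \<open>A\<close>; the sets \<open>A\<close> exhaust the space as \<open>C\<close> grows.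
\<close>

subsection \<open>The pointwise ergodic theorem\<close>

text \<open>If the lower limit were smaller than the upper one, two rationals would fit strictly
  between them and be crossed infinitely often; the two bounds keep the common value finite. Testing
  only rational levels keeps the later exceptional sets countable in number.\<close>

lemma convergent_if_no_oscillation:
  fixes X :: "nat \<Rightarrow> real"
  assumes above: "eventually (\<lambda>n. X n \<le> u) sequentially"
    and below: "eventually (\<lambda>n. l \<le> X n) sequentially"
    and gap: "\<And>a b. a \<in> \<rat> \<Longrightarrow> b \<in> \<rat> \<Longrightarrow> a < b \<Longrightarrow>
      \<not> ((\<exists>\<^sub>F n in sequentially. X n < a) \<and> (\<exists>\<^sub>F n in sequentially. b < X n))"
  shows "convergent X"
proof -
  let ?Y = "\<lambda>n. ereal (X n)"
  have "limsup ?Y \<le> liminf ?Y"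
  proof (rule ccontr)
    assume "\<not> limsup ?Y \<le> liminf ?Y"
    then obtain r where r: "liminf ?Y < ereal (real_of_rat r)" "ereal (real_of_rat r) < limsup ?Y"
      using ereal_dense3[of "liminf ?Y" "limsup ?Y"] by (meson not_le)
    obtain s where s: "ereal (real_of_rat r) < ereal (real_of_rat s)"
        "ereal (real_of_rat s) < limsup ?Y"
      using ereal_dense3[OF r(2)] by auto
    have "\<exists>\<^sub>F n in sequentially. X n < real_of_rat r"
    proof (rule ccontr)
      assume "\<not> (\<exists>\<^sub>F n in sequentially. X n < real_of_rat r)"
      then have "eventually (\<lambda>n. ereal (real_of_rat r) \<le> ?Y n) sequentially"
        by (simp add: not_frequently not_less)
      then have "ereal (real_of_rat r) \<le> liminf ?Y" by (rule Liminf_bounded)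
      with r(1) show False by simp
    qed
    moreover have "\<exists>\<^sub>F n in sequentially. real_of_rat s < X n"
    proof (rule ccontr)
      assume "\<not> (\<exists>\<^sub>F n in sequentially. real_of_rat s < X n)"
      then have "eventually (\<lambda>n. ?Y n \<le> ereal (real_of_rat s)) sequentially"
        by (simp add: not_frequently not_less)
      then have "limsup ?Y \<le> ereal (real_of_rat s)" by (rule Limsup_bounded)
      with s(2) show False by simp
    qed
    ultimately show False
      using gap[of "real_of_rat r" "real_of_rat s"] s(1) by auto
  qed
  then have eq: "liminf ?Y = limsup ?Y"
    using Liminf_le_Limsup[of sequentially ?Y] by auto
  have "limsup ?Y \<le> ereal u" using above by (intro Limsup_bounded) simp
  moreover have "ereal l \<le> liminf ?Y" using below by (intro Liminf_bounded) simp
  ultimately have "\<bar>limsup ?Y\<bar> \<noteq> \<infinity>" using eq by auto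
  then obtain L where L: "limsup ?Y = ereal L" by auto
  have "?Y \<longlonglongrightarrow> ereal L"
    using eq L by (intro Liminf_eq_Limsup trivial_limit_sequentially) auto
  then show ?thesis by (auto simp: convergent_def)
qed

lemma linear_eventually_le:
  fixes b e :: real
  assumes "0 < e"
  shows "\<exists>N. \<forall>n\<ge>N. b \<le> e * real n"
proof -
  obtain N where N: "b / e \<le> real N" using real_arch_simple by blast
  have "b \<le> e * real n" if "n \<ge> N" for n
  proof -
    have "b / e \<le> real n" using N that by linarith
    then show ?thesis using assms by (simp add: field_simps)
  qed
  then show ?thesis by blast
qed

section \<open>Birkhoff sums and their running maxima\<close>

definition birkhoff_sum :: "('a \<Rightarrow> 'a) \<Rightarrow> ('a \<Rightarrow> real) \<Rightarrow> nat \<Rightarrow> 'a \<Rightarrow> real" where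
  "birkhoff_sum T f n x = (\<Sum>k<n. f ((T ^^ k) x))"

lemma birkhoff_sum_0 [simp]: "birkhoff_sum T f 0 x = 0"
  by (simp add: birkhoff_sum_def)

lemma birkhoff_sum_Suc: "birkhoff_sum T f (Suc n) x = birkhoff_sum T f n x + f ((T ^^ n) x)"
  by (simp add: birkhoff_sum_def)

lemma birkhoff_sum_Suc_shift: "birkhoff_sum T f (Suc n) x = f x + birkhoff_sum T f n (T x)"
  unfolding birkhoff_sum_def by (subst sum.lessThan_Suc_shift) (simp add: funpow_swap1)

lemma birkhoff_sum_uminus: "birkhoff_sum T (\<lambda>x. - f x) n x = - birkhoff_sum T f n x"
  by (simp add: birkhoff_sum_def sum_negf)

lemma birkhoff_sum_diff_const:
  "birkhoff_sum T (\<lambda>x. f x - c) n x = birkhoff_sum T f n x - c * real n"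
  by (simp add: birkhoff_sum_def sum_subtractf)

lemma ergodic_average_eq: "ergodic_average T f n x = birkhoff_sum T f n x / real n"
  by (simp add: ergodic_average_def birkhoff_sum_def)

text \<open>This is the maximum of \<open>birkhoff_sum T f k x\<close> over
  \<open>k \<le> n\<close>. The recursion builds in the comparison between \<open>x\<close> and
  \<open>T x\<close> on which the maximal ergodic theorem rests.\<close>

fun birkhoff_max :: "('a \<Rightarrow> 'a) \<Rightarrow> ('a \<Rightarrow> real) \<Rightarrow> nat \<Rightarrow> 'a \<Rightarrow> real" where
  "birkhoff_max T f 0 x = 0"
| "birkhoff_max T f (Suc n) x = max 0 (f x + birkhoff_max T f n (T x))"

lemma birkhoff_max_nonneg: "0 \<le> birkhoff_max T f n x"
  by (cases n) auto

lemma birkhoff_sum_le_birkhoff_max: "k \<le> n \<Longrightarrow> birkhoff_sum T f k x \<le> birkhoff_max T f n x"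
proof (induction n arbitrary: k x)
  case (Suc n)
  show ?case
  proof (cases k)
    case (Suc j)
    then show ?thesis
      using Suc.IH[of j "T x"] Suc.prems by (simp add: birkhoff_sum_Suc_shift le_max_iff_disj)
  qed simp
qed simp

lemma birkhoff_max_attained: "\<exists>k\<le>n. birkhoff_max T f n x = birkhoff_sum T f k x"
proof (induction n arbitrary: x)
  case (Suc n)
  obtain k where k: "k \<le> n" "birkhoff_max T f n (T x) = birkhoff_sum T f k (T x)"
    using Suc by blast
  then have "birkhoff_max T f (Suc n) x = max 0 (birkhoff_sum T f (Suc k) x)"
    by (simp add: birkhoff_sum_Suc_shift)
  then show ?case using k(1) by (cases "0 \<le> birkhoff_sum T f (Suc k) x") (force simp: max_def)+
qed simp

lemma birkhoff_max_mono: "m \<le> n \<Longrightarrow> birkhoff_max T f m x \<le> birkhoff_max T f n x"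
  by (metis birkhoff_max_attained birkhoff_sum_le_birkhoff_max order_trans)

lemma integrable_indicator_mult:
  fixes f :: "'a \<Rightarrow> real"
  shows "A \<in> sets M \<Longrightarrow> integrable M f \<Longrightarrow> integrable M (\<lambda>x. indicator A x * f x)"
  using integrable_mult_indicator[of A M f] by simp

section \<open>Measure-preserving maps and the maximal ergodic theorem\<close>

locale prob_preserving = prob_space M for M :: "'a measure" +
  fixes T :: "'a \<Rightarrow> 'a"
  assumes measurable_T [measurable]: "T \<in> M \<rightarrow>\<^sub>M M"
    and distr_T: "distr M M T = M"
begin

lemma T_in_space: "x \<in> space M \<Longrightarrow> T x \<in> space M"
  using measurable_T by (rule measurable_space)

lemma funpow_in_space: "x \<in> space M \<Longrightarrow> (T ^^ n) x \<in> space M"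
  by (induction n) (auto simp: T_in_space)

lemma distr_funpow: "distr M M (T ^^ n) = M"
proof (induction n)
  case (Suc n)
  have "distr M M (T ^^ Suc n) = distr (distr M M (T ^^ n)) M T"
    by (simp add: distr_distr comp_def)
  then show ?case using Suc distr_T by (simp add: comp_def)
qed (simp add: distr_id id_def)

lemma emeasure_funpow_vimage:
  assumes "A \<in> sets M"
  shows "emeasure M ((T ^^ n) -` A \<inter> space M) = emeasure M A"
  using assms emeasure_distr[of "T ^^ n" M M A] by (simp add: distr_funpow)

lemma measure_funpow_vimage:
  "A \<in> sets M \<Longrightarrow> measure M ((T ^^ n) -` A \<inter> space M) = measure M A"
  by (simp add: measure_def emeasure_funpow_vimage)

lemma AE_funpow: "AE x in M. P x \<Longrightarrow> AE x in M. P ((T ^^ n) x)"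
  by (rule AE_distrD[OF measurable_compose_n[OF measurable_T]]) (subst distr_funpow)

lemma integrable_comp_T:
  fixes g :: "'a \<Rightarrow> real"
  shows "integrable M g \<Longrightarrow> integrable M (\<lambda>x. g (T x))"
  using integrable_distr[of T M M g] by (simp add: distr_T)

lemma integral_comp_T:
  fixes g :: "'a \<Rightarrow> real"
  shows "g \<in> borel_measurable M \<Longrightarrow> (\<integral>x. g (T x) \<partial>M) = (\<integral>x. g x \<partial>M)"
  using integral_distr[of T M M g] by (simp add: distr_T)

lemma birkhoff_sum_measurable [measurable]:
  "f \<in> borel_measurable M \<Longrightarrow> birkhoff_sum T f n \<in> borel_measurable M"
  unfolding birkhoff_sum_def
  by (intro borel_measurable_sum measurable_compose[OF measurable_compose_n[OF measurable_T]])

lemma birkhoff_max_integrable: "integrable M f \<Longrightarrow> integrable M (birkhoff_max T f n)"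
proof (induction n)
  case (Suc n)
  then have "integrable M (\<lambda>x. max 0 (f x + birkhoff_max T f n (T x)))"
    by (intro integrable_max integrable_zero Bochner_Integration.integrable_add
        integrable_comp_T[of "birkhoff_max T f n"])
  moreover have "birkhoff_max T f (Suc n) = (\<lambda>x. max 0 (f x + birkhoff_max T f n (T x)))"
    by (rule ext) simp
  ultimately show ?case by simp
next
  case 0
  have "birkhoff_max T f 0 = (\<lambda>x. 0)" by (rule ext) simp
  then show ?case by simp
qed

text \<open>Garsia's argument: where \<open>birkhoff_max T f (Suc n)\<close> is positive, its
  difference from \<open>birkhoff_max T f n (T x)\<close> is exactly \<open>f x\<close>; elsewhere
  it is 0 and the difference is at most 0. Invariance of the integral and monotonicity in
  \<open>n\<close> make the integrated difference nonnegative.\<close>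

theorem maximal_ergodic:
  assumes f: "integrable M f"
  shows "0 \<le> (\<integral>x. indicator {x \<in> space M. \<exists>n. 0 < birkhoff_sum T f n x} x * f x \<partial>M)"
proof -
  define A where "A n = {x \<in> space M. 0 < birkhoff_max T f n x}" for n
  let ?B = "{x \<in> space M. \<exists>n. 0 < birkhoff_sum T f n x}"
  have [measurable]: "f \<in> borel_measurable M" using f by auto
  have [measurable]: "birkhoff_max T f n \<in> borel_measurable M" for n
    using birkhoff_max_integrable[OF f] by auto
  have [measurable]: "A n \<in> sets M" for n unfolding A_def by measurable
  have "0 \<le> (\<integral>x. indicator (A (Suc n)) x * f x \<partial>M)" for n
  proof -
    let ?m = "birkhoff_max T f"
    have "(\<integral>x. ?m n (T x) \<partial>M) = (\<integral>x. ?m n x \<partial>M)" by (rule integral_comp_T) simp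
    also have "\<dots> \<le> (\<integral>x. ?m (Suc n) x \<partial>M)"
      by (intro integral_mono birkhoff_max_integrable f birkhoff_max_mono) simp
    finally have "0 \<le> (\<integral>x. ?m (Suc n) x \<partial>M) - (\<integral>x. ?m n (T x) \<partial>M)" by simp
    also have "\<dots> = (\<integral>x. ?m (Suc n) x - ?m n (T x) \<partial>M)"
      by (intro Bochner_Integration.integral_diff[symmetric] integrable_comp_T
          birkhoff_max_integrable f)
    also have "\<dots> \<le> (\<integral>x. indicator (A (Suc n)) x * f x \<partial>M)"
    proof (rule integral_mono)
      show "integrable M (\<lambda>x. ?m (Suc n) x - ?m n (T x))"
        by (intro Bochner_Integration.integrable_diff integrable_comp_T birkhoff_max_integrable f)
      show "integrable M (\<lambda>x. indicator (A (Suc n)) x * f x)"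
        using f by (intro integrable_indicator_mult) auto
      show "?m (Suc n) x - ?m n (T x) \<le> indicator (A (Suc n)) x * f x" if "x \<in> space M" for x
        using that birkhoff_max_nonneg[of T f n "T x"]
        by (auto simp: A_def indicator_def max_def split: if_splits)
    qed
    finally show ?thesis .
  qed
  \<comment> \<open>The sets \<open>A (Suc n)\<close> increase to \<open>?B\<close>, because a
    running maximum is positive exactly when one of the sums entering it is.\<close>
  moreover have "(\<lambda>n. \<integral>x. indicator (A (Suc n)) x * f x \<partial>M) \<longlonglongrightarrow> (\<integral>x. indicator ?B x * f x \<partial>M)"
  proof (rule integral_dominated_convergence[where w = "\<lambda>x. \<bar>f x\<bar>"])
    show "AE x in M. (\<lambda>n. indicator (A (Suc n)) x * f x) \<longlonglongrightarrow> indicator ?B x * f x"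
    proof (intro AE_I2 tendsto_mult tendsto_const)
      fix x assume x: "x \<in> space M"
      show "(\<lambda>n. indicator (A (Suc n)) x :: real) \<longlonglongrightarrow> indicator ?B x"
      proof (cases "x \<in> ?B")
        case True
        then obtain k where k: "0 < birkhoff_sum T f k x" by auto
        have "x \<in> A (Suc n)" if "n \<ge> k" for n
          using birkhoff_sum_le_birkhoff_max[of k "Suc n" T f x] k x that
          unfolding A_def by simp
        then have "eventually (\<lambda>n. indicator (A (Suc n)) x = (1::real)) sequentially"
          by (auto simp: eventually_sequentially indicator_def)
        then show ?thesis using True by (simp add: tendsto_eventually)
      next
        case False
        have "x \<notin> A (Suc n)" for n
          using birkhoff_max_attained[of "Suc n" T f x] False x
          by (auto simp: A_def simp del: birkhoff_max.simps)
        then show ?thesis using False by simp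
      qed
    qed
  qed (use f in \<open>auto simp: indicator_def\<close>)
  ultimately show ?thesis by (intro LIMSEQ_le_const) auto
qed

section \<open>Invariant sets with large averages, and almost everywhere convergence\<close>

text \<open>The maximal theorem is applied to \<open>f - c\<close> cut off outside \<open>E\<close>.
  Invariance lets the cutoff factor out of every orbit sum, so the set of points with a positive sum
  is \<open>E\<close> itself.\<close>

lemma maximal_ergodic_invariant:
  assumes f: "integrable M f" and E: "E \<in> sets M"
    and inv: "\<And>x. x \<in> space M \<Longrightarrow> T x \<in> E \<longleftrightarrow> x \<in> E"
    and pos: "\<And>x. x \<in> E \<Longrightarrow> \<exists>n. c * real n < birkhoff_sum T f n x"
  shows "c * measure M E \<le> (\<integral>x. indicator E x * f x \<partial>M)"
proof -
  define g where "g x = indicator E x * (f x - c)" for x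
  have int: "integrable M g"
    unfolding g_def using E f
    by (intro integrable_indicator_mult) auto
  have "indicator E ((T ^^ n) x) = (indicator E x :: real)" if "x \<in> space M" for n x
    using that by (induction n) (auto simp: indicator_def inv funpow_in_space)
  then have g: "birkhoff_sum T g n x = indicator E x * (birkhoff_sum T f n x - c * real n)"
    if "x \<in> space M" for n x
    using that birkhoff_sum_diff_const[of T f c n x]
    by (simp add: birkhoff_sum_def g_def sum_distrib_left[symmetric])
  have "0 \<le> (\<integral>x. indicator {x \<in> space M. \<exists>n. 0 < birkhoff_sum T g n x} x * g x \<partial>M)"
    by (rule maximal_ergodic[OF int])
  also have "\<dots> = (\<integral>x. g x \<partial>M)"
  proof (rule Bochner_Integration.integral_cong)
    show "indicator {x \<in> space M. \<exists>n. 0 < birkhoff_sum T g n x} x * g x = g x"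
      if "x \<in> space M" for x
    proof (cases "x \<in> E")
      case True
      then show ?thesis using pos[of x] that by (auto simp: g)
    qed (simp add: g_def)
  qed simp
  also have "\<dots> = (\<integral>x. indicator E x * f x - c * indicator E x \<partial>M)"
    by (simp add: g_def algebra_simps)
  also have "\<dots> = (\<integral>x. indicator E x * f x \<partial>M) - c * measure M E"
    using E f by (subst Bochner_Integration.integral_diff)
      (auto intro!: integrable_indicator_mult simp: emeasure_eq_measure)
  finally show ?thesis by simp
qed

text \<open>The margin \<open>1 / Suc k\<close> absorbs the boundary term between the sums at \<open>x\<close> and at \<open>T x\<close>
  and so makes the set exactly invariant.\<close>

definition upper_set :: "('a \<Rightarrow> real) \<Rightarrow> real \<Rightarrow> 'a set" where
  "upper_set f c = {x \<in> space M. \<exists>k. \<exists>\<^sub>\<infinity>n. (c + 1 / real (Suc k)) * real n < birkhoff_sum T f n x}"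

lemma upper_set_measurable [measurable]:
  "f \<in> borel_measurable M \<Longrightarrow> upper_set f c \<in> sets M"
  unfolding upper_set_def INFM_nat by measurable

text \<open>Some \<open>1 / Suc k\<close> is smaller than \<open>d - c\<close>, so exceeding any
  fixed level above \<open>c\<close> infinitely often is enough for membership.\<close>

lemma upper_setI:
  assumes "x \<in> space M" "c < d" "\<exists>\<^sub>\<infinity>n. d * real n < birkhoff_sum T f n x"
  shows "x \<in> upper_set f c"
proof -
  obtain k where k: "1 / real (Suc k) < d - c"
    using nat_approx_posE[of "d - c"] assms(2) by auto
  have "(c + 1 / real (Suc k)) * real n \<le> d * real n" for n
    using k by (intro mult_right_mono) auto
  then have "\<exists>\<^sub>\<infinity>n. (c + 1 / real (Suc k)) * real n < birkhoff_sum T f n x"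
    using assms(3) by (elim INFM_mono) (rule le_less_trans)
  then show ?thesis using assms(1) unfolding upper_set_def by blast
qed

lemma upper_setD:
  assumes "x \<in> upper_set f c"
  shows "\<exists>n. c * real n < birkhoff_sum T f n x"
proof -
  obtain k where "\<exists>\<^sub>\<infinity>n. (c + 1 / real (Suc k)) * real n < birkhoff_sum T f n x"
    using assms unfolding upper_set_def by auto
  then obtain n where n: "(c + 1 / real (Suc k)) * real n < birkhoff_sum T f n x"
    by (auto simp: INFM_nat)
  have "c * real n \<le> (c + 1 / real (Suc k)) * real n" by (intro mult_right_mono) auto
  with n show ?thesis by (metis le_less_trans)
qed

text \<open>The sums of length \<open>Suc n\<close> at \<open>x\<close> and of length
  \<open>n\<close> at \<open>T x\<close> differ by the constant \<open>f x\<close>. For large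
  \<open>n\<close>, half of the margin \<open>e\<close> pays for this constant and for the index
  shift; the other half keeps the average above \<open>c\<close>.\<close>

lemma upper_set_invariant:
  assumes x: "x \<in> space M"
  shows "T x \<in> upper_set f c \<longleftrightarrow> x \<in> upper_set f c"
proof
  assume "T x \<in> upper_set f c"
  then obtain k where k: "\<exists>\<^sub>\<infinity>n. (c + 1 / real (Suc k)) * real n < birkhoff_sum T f n (T x)"
    unfolding upper_set_def by blast
  define e where "e = 1 / real (Suc k)"
  have e: "0 < e / 2" by (simp add: e_def)
  obtain N where N: "\<And>n. n \<ge> N \<Longrightarrow> c + e / 2 - f x \<le> (e / 2) * real n"
    using linear_eventually_le[OF e] by blast
  show "x \<in> upper_set f c"
  proof (rule upper_setI[OF x, of c "c + e / 2"])
    show "\<exists>\<^sub>\<infinity>n. (c + e / 2) * real n < birkhoff_sum T f n x"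
      unfolding INFM_nat_le
    proof
      fix m
      obtain n where n: "n \<ge> max N m" "(c + e) * real n < birkhoff_sum T f n (T x)"
        using k unfolding INFM_nat_le e_def by blast
      have "(c + e / 2) * real (Suc n) < birkhoff_sum T f (Suc n) x"
        using n N[of n] by (simp add: birkhoff_sum_Suc_shift algebra_simps) argo
      then show "\<exists>n\<ge>m. (c + e / 2) * real n < birkhoff_sum T f n x"
        using n(1) by (intro exI[of _ "Suc n"]) auto
    qed
  qed (use e in simp)
next
  assume "x \<in> upper_set f c"
  then obtain k where k: "\<exists>\<^sub>\<infinity>n. (c + 1 / real (Suc k)) * real n < birkhoff_sum T f n x"
    unfolding upper_set_def by blast
  define e where "e = 1 / real (Suc k)"
  have e: "0 < e / 2" by (simp add: e_def)
  obtain N where N: "\<And>n. n \<ge> N \<Longrightarrow> f x - (c + e) \<le> (e / 2) * real n"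
    using linear_eventually_le[OF e] by blast
  show "T x \<in> upper_set f c"
  proof (rule upper_setI[OF T_in_space[OF x], of c "c + e / 2"])
    show "\<exists>\<^sub>\<infinity>n. (c + e / 2) * real n < birkhoff_sum T f n (T x)"
      unfolding INFM_nat_le
    proof
      fix m
      \<comment> \<open>The \<open>Suc\<close> in the lower bound makes \<open>n'\<close> a
        successor whose predecessor is still at least \<open>max N m\<close>.\<close>
      obtain n' where n': "n' \<ge> Suc (max N m)" "(c + e) * real n' < birkhoff_sum T f n' x"
        using k unfolding INFM_nat_le e_def by blast
      then obtain n where n: "n' = Suc n" "n \<ge> max N m" by (cases n') auto
      have "(c + e / 2) * real n < birkhoff_sum T f n (T x)"
        using n'(2) N[of n] n by (simp add: birkhoff_sum_Suc_shift algebra_simps)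
      then show "\<exists>n\<ge>m. (c + e / 2) * real n < birkhoff_sum T f n (T x)"
        using n(2) by (intro exI[of _ n]) auto
    qed
  qed (use e in simp)
qed

text \<open>Allowing any invariant subset of the upper set makes the bound available on
  intersections of several upper sets.\<close>

lemma measure_upper_set_le:
  assumes "integrable M f" "E \<in> sets M" "E \<subseteq> upper_set f c"
    and "\<And>x. x \<in> space M \<Longrightarrow> T x \<in> E \<longleftrightarrow> x \<in> E"
  shows "c * measure M E \<le> (\<integral>x. indicator E x * f x \<partial>M)"
  using assms by (intro maximal_ergodic_invariant upper_setD) auto

text \<open>On the intersection of all these sets, which is invariant, the integral of
  \<open>f\<close> is at least \<open>j\<close> times the measure for every \<open>j\<close>, so the
  measure is 0.\<close>

lemma AE_bounded_above:
  assumes f: "integrable M f"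
  shows "AE x in M. \<exists>j::nat. x \<notin> upper_set f (real j)"
proof -
  have [measurable]: "f \<in> borel_measurable M" using f by auto
  let ?E = "\<Inter>j::nat. upper_set f (real j)"
  have E: "?E \<in> sets M" by measurable
  have bound: "real j * measure M ?E \<le> (\<integral>x. indicator ?E x * f x \<partial>M)" for j :: nat
    using E by (intro measure_upper_set_le f) (auto simp: upper_set_invariant)
  have "measure M ?E = 0"
  proof (rule ccontr)
    assume "measure M ?E \<noteq> 0"
    then have "0 < measure M ?E" using measure_nonneg[of M ?E] by linarith
    then obtain j :: nat where "(\<integral>x. indicator ?E x * f x \<partial>M) < real j * measure M ?E"
      using reals_Archimedean3 by blast
    with bound[of j] show False by linarith
  qed
  then have "AE x in M. x \<notin> ?E"
    using E by (intro AE_not_in) (simp add: null_sets_def emeasure_eq_measure)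
  then show ?thesis by simp
qed

text \<open>Bounds for \<open>f\<close> and for \<open>- f\<close> on the same invariant set
  \<open>?E\<close> place its integral of \<open>f\<close> between \<open>b\<close> and
  \<open>a\<close> times its measure, which for \<open>a < b\<close> forces measure 0.\<close>

lemma AE_no_oscillation:
  assumes f: "integrable M f" and "a < b"
  shows "AE x in M. \<not> (x \<in> upper_set f b \<and> x \<in> upper_set (\<lambda>x. - f x) (- a))"
proof -
  have [measurable]: "f \<in> borel_measurable M" using f by auto
  let ?E = "upper_set f b \<inter> upper_set (\<lambda>x. - f x) (- a)"
  have E: "?E \<in> sets M" by measurable
  have "b * measure M ?E \<le> (\<integral>x. indicator ?E x * f x \<partial>M)"
    by (intro measure_upper_set_le f E) (auto simp: upper_set_invariant)
  moreover have "(- a) * measure M ?E \<le> (\<integral>x. indicator ?E x * (- f x) \<partial>M)"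
    using f by (intro measure_upper_set_le E) (auto simp: upper_set_invariant)
  ultimately have "(b - a) * measure M ?E \<le> 0" by (simp add: algebra_simps)
  then have "measure M ?E = 0"
    using \<open>a < b\<close> measure_nonneg[of M ?E] by (simp add: mult_le_0_iff)
  then have "AE x in M. x \<notin> ?E"
    using E by (intro AE_not_in) (simp add: null_sets_def emeasure_eq_measure)
  then show ?thesis by simp
qed

lemma not_in_upper_setD:
  assumes "x \<in> space M" "x \<notin> upper_set f c" "c < d"
  shows "eventually (\<lambda>n. birkhoff_sum T f n x / real n \<le> d) sequentially"
proof -
  have "\<not> (\<exists>\<^sub>\<infinity>n. d * real n < birkhoff_sum T f n x)"
    using upper_setI[OF assms(1,3), of f] assms(2) by blast
  then have "eventually (\<lambda>n. birkhoff_sum T f n x \<le> d * real n) sequentially"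
    by (simp only: not_frequently not_less cofinite_eq_sequentially)
  then show ?thesis
    using eventually_gt_at_top[of 0] by eventually_elim (simp add: field_simps)
qed

theorem birkhoff_ergodic_convergent:
  assumes f: "integrable M f"
  shows "AE x in M. convergent (\<lambda>n. birkhoff_sum T f n x / real n)"
proof -
  let ?g = "\<lambda>x. - f x"
  have g: "integrable M ?g" using f by simp
  have "AE x in M. \<forall>a\<in>\<rat>. \<forall>b\<in>\<rat>. a < b \<longrightarrow> \<not> (x \<in> upper_set f b \<and> x \<in> upper_set ?g (- a))"
    using AE_no_oscillation[OF f]
    by (intro AE_ball_countable[THEN iffD2] countable_rat ballI) (auto intro: AE_I2)
  with AE_bounded_above[OF f] AE_bounded_above[OF g] AE_space show ?thesis
  proof eventually_elim
    case (elim x)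
    note x = \<open>x \<in> space M\<close>
    obtain j k :: nat where j: "x \<notin> upper_set f (real j)" and k: "x \<notin> upper_set ?g (real k)"
      using elim by blast
    show ?case
    proof (rule convergent_if_no_oscillation)
      show "eventually (\<lambda>n. birkhoff_sum T f n x / real n \<le> real j + 1) sequentially"
        by (rule not_in_upper_setD[OF x j]) simp
      show "eventually (\<lambda>n. - (real k + 1) \<le> birkhoff_sum T f n x / real n) sequentially"
        using not_in_upper_setD[OF x k, of "real k + 1"]
        by (simp add: birkhoff_sum_uminus) (elim eventually_mono, linarith)
      fix a b :: real
      assume ab: "a \<in> \<rat>" "b \<in> \<rat>" "a < b"
      \<comment> \<open>Lying outside an upper set only yields an eventual bound at a strictly
        larger level, so an inner rational pair is inserted, leaving room on both sides.\<close>
      define a' where "a' = (2 * a + b) / 3"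
      define b' where "b' = (a + 2 * b) / 3"
      have ab': "a' \<in> \<rat>" "b' \<in> \<rat>" "a < a'" "a' < b'" "b' < b"
        using ab by (auto simp: a'_def b'_def)
      then consider "x \<notin> upper_set f b'" | "x \<notin> upper_set ?g (- a')" using elim by blast
      then show "\<not> ((\<exists>\<^sub>F n in sequentially. birkhoff_sum T f n x / real n < a) \<and>
        (\<exists>\<^sub>F n in sequentially. b < birkhoff_sum T f n x / real n))"
      proof cases
        case 1
        from not_in_upper_setD[OF x this, of b] ab' show ?thesis
          by (simp add: not_frequently not_less)
      next
        case 2
        from not_in_upper_setD[OF x this, of "- a"] ab' show ?thesis
          by (simp add: not_frequently not_less birkhoff_sum_uminus)
      qed
    qed
  qed
qed

end

subsection \<open>Return times and excursion sums\<close>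

text \<open>By invariance the event \<open>e * real n < g ((T ^^ n) x)\<close> has the measure of
  \<open>C n\<close>, which tends to 0; hence it can hold for all \<open>n \<ge> N\<close> only on a
  null set. This will exclude a positive limit of age divided by time.\<close>

lemma (in prob_preserving) AE_frequently_le_linear:
  fixes g :: "'a \<Rightarrow> real"
  assumes [measurable]: "g \<in> borel_measurable M" and e: "0 < e"
  shows "AE x in M. \<exists>\<^sub>F n in sequentially. g ((T ^^ n) x) \<le> e * real n"
proof -
  define C where "C n = {y \<in> space M. e * real n < g y}" for n :: nat
  have C [measurable]: "C n \<in> sets M" for n unfolding C_def by measurable
  have "decseq C"
    unfolding decseq_def C_def
  proof safe
    fix m n :: nat and y assume "m \<le> n" "e * real n < g y"
    moreover have "e * real m \<le> e * real n" using e \<open>m \<le> n\<close> by simp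
    ultimately show "e * real m < g y" by linarith
  qed
  moreover have "(\<Inter>n. C n) = {}"
  proof -
    have "\<exists>n. g y \<le> e * real n" for y using linear_eventually_le[OF e] by blast
    then show ?thesis unfolding C_def by (auto simp: not_less[symmetric])
  qed
  moreover have "range C \<subseteq> sets M" using C by auto
  ultimately have C_lim: "(\<lambda>n. measure M (C n)) \<longlonglongrightarrow> 0"
    using finite_Lim_measure_decseq[of C] by simp
  have "AE x in M. \<not> (\<forall>n\<ge>N. e * real n < g ((T ^^ n) x))" for N
  proof -
    define B where "B = {x \<in> space M. \<forall>n\<ge>N. e * real n < g ((T ^^ n) x)}"
    have B: "B \<in> sets M" unfolding B_def by measurable
    have "measure M B \<le> measure M (C n)" if "n \<ge> N" for n
    proof -
      have "measure M B \<le> measure M ((T ^^ n) -` C n \<inter> space M)"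
        using that by (intro finite_measure_mono)
          (auto simp: B_def C_def funpow_in_space
            intro!: measurable_sets[OF measurable_compose_n[OF measurable_T] C[unfolded C_def]])
      then show ?thesis by (simp add: measure_funpow_vimage)
    qed
    then have "measure M B \<le> 0"
      by (intro LIMSEQ_le_const[OF C_lim]) auto
    then have "AE x in M. x \<notin> B"
      using B measure_nonneg[of M B]
      by (intro AE_not_in) (simp add: null_sets_def emeasure_eq_measure)
    then show ?thesis using AE_space by eventually_elim (auto simp: B_def)
  qed
  then have "AE x in M. \<forall>N. \<not> (\<forall>n\<ge>N. e * real n < g ((T ^^ n) x))"
    by (simp add: AE_all_countable)
  then show ?thesis
    by eventually_elim (auto simp: frequently_sequentially not_less)
qed

section \<open>Invertible maps: age, excursion sums and return sums\<close>

locale invertible_prob_preserving = prob_preserving +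
  fixes T' :: "'a \<Rightarrow> 'a"
  assumes measurable_T' [measurable]: "T' \<in> M \<rightarrow>\<^sub>M M"
    and T'_T: "x \<in> space M \<Longrightarrow> T' (T x) = x"
    and T_T': "x \<in> space M \<Longrightarrow> T (T' x) = x"
begin

lemma T'_in_space: "x \<in> space M \<Longrightarrow> T' x \<in> space M"
  using measurable_T' by (rule measurable_space)

lemma funpow_T'_in_space: "x \<in> space M \<Longrightarrow> (T' ^^ n) x \<in> space M"
  by (induction n) (auto simp: T'_in_space)

lemma funpow_T'_Suc_T: "x \<in> space M \<Longrightarrow> (T' ^^ Suc n) (T x) = (T' ^^ n) x"
  by (simp add: funpow_Suc_right T'_T del: funpow.simps)

lemma funpow_T'_T: "x \<in> space M \<Longrightarrow> (T' ^^ n) ((T ^^ n) x) = x"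
proof (induction n)
  case (Suc n)
  then show ?case using funpow_T'_Suc_T[of "(T ^^ n) x" n] by (simp add: funpow_in_space)
qed simp

lemma funpow_T_T': "x \<in> space M \<Longrightarrow> (T ^^ n) ((T' ^^ n) x) = x"
proof (induction n)
  case (Suc n)
  have "(T ^^ Suc n) ((T' ^^ Suc n) x) = (T ^^ n) (T (T' ((T' ^^ n) x)))"
    by (simp add: funpow_swap1)
  then show ?case using Suc by (simp add: T_T' funpow_T'_in_space)
qed simp

text \<open>The forward orbit of \<open>A\<close> within the space. Writing it with
  \<open>T'\<close> presents it as a countable union of preimages, which are measurable when
  \<open>A\<close> is.\<close>

definition visited :: "'a set \<Rightarrow> 'a set" where
  "visited A = {y \<in> space M. \<exists>k. (T' ^^ k) y \<in> A}"

text \<open>Outside \<open>visited A\<close> the age is an unspecified number.\<close>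

definition age :: "'a set \<Rightarrow> 'a \<Rightarrow> nat" where
  "age A y = (LEAST k. (T' ^^ k) y \<in> A)"

text \<open>The \<open>u\<close> of the overview: the sum starts at the last visit to
  \<open>A\<close> and stops just before \<open>y\<close>, so it is 0 on \<open>A\<close>.\<close>

definition excursion_sum :: "'a set \<Rightarrow> ('a \<Rightarrow> real) \<Rightarrow> 'a \<Rightarrow> real" where
  "excursion_sum A f y = birkhoff_sum T f (age A y) ((T' ^^ age A y) y)"

text \<open>The \<open>F\<close> of the overview, recorded one step before the return. The
  \<open>Suc\<close> includes the term \<open>f y\<close>, so that the whole excursion is
  covered.\<close>

definition return_sum :: "'a set \<Rightarrow> ('a \<Rightarrow> real) \<Rightarrow> 'a \<Rightarrow> real" where
  "return_sum A f y =
    (if y \<in> visited A \<and> T y \<in> A then birkhoff_sum T f (Suc (age A y)) ((T' ^^ age A y) y) else 0)"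

lemma funpow_age_in: "y \<in> visited A \<Longrightarrow> (T' ^^ age A y) y \<in> A"
  unfolding visited_def age_def by (auto intro: LeastI)

lemma age_le: "(T' ^^ k) y \<in> A \<Longrightarrow> age A y \<le> k"
  unfolding age_def by (rule Least_le)

lemma age_in: "y \<in> A \<Longrightarrow> age A y = 0"
  using age_le[of 0 y A] by simp

lemma visited_T:
  assumes "y \<in> visited A"
  shows "T y \<in> visited A"
proof -
  obtain k where "(T' ^^ k) y \<in> A" "y \<in> space M" using assms unfolding visited_def by auto
  then show ?thesis
    using funpow_T'_Suc_T[of y k] T_in_space unfolding visited_def by (auto intro!: exI[of _ "Suc k"])
qed

lemma visited_funpow: "y \<in> visited A \<Longrightarrow> (T ^^ n) y \<in> visited A"
  by (induction n) (auto simp: visited_T)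

lemma age_T:
  assumes "y \<in> visited A" "T y \<notin> A"
  shows "age A (T y) = Suc (age A y)"
proof -
  have y: "y \<in> space M" using assms(1) by (simp add: visited_def)
  obtain k where "(T' ^^ k) y \<in> A" using assms(1) unfolding visited_def by auto
  then have "(T' ^^ Suc k) (T y) \<in> A" by (simp only: funpow_T'_Suc_T[OF y])
  then have "age A (T y) = Suc (LEAST m. (T' ^^ Suc m) (T y) \<in> A)"
    unfolding age_def by (rule Least_Suc) (simp add: assms(2))
  then show ?thesis by (simp only: funpow_T'_Suc_T[OF y] age_def)
qed

text \<open>While \<open>T y\<close> stays outside \<open>A\<close>, the excursion sum grows by
  \<open>f y\<close> and the return sum is 0. On return the excursion sum drops to 0, and the return
  sum records the lost total together with \<open>f y\<close>.\<close>

lemma return_sum_coboundary: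
  assumes y: "y \<in> visited A"
  shows "f y = return_sum A f y + excursion_sum A f (T y) - excursion_sum A f y"
proof -
  have sp: "y \<in> space M" using y by (simp add: visited_def)
  have step: "birkhoff_sum T f (Suc (age A y)) ((T' ^^ age A y) y) = excursion_sum A f y + f y"
    by (simp add: birkhoff_sum_Suc excursion_sum_def funpow_T_T'[OF sp])
  show ?thesis
  proof (cases "T y \<in> A")
    case True
    then show ?thesis using y step
      by (simp add: return_sum_def excursion_sum_def age_in)
  next
    case False
    have "excursion_sum A f (T y) = birkhoff_sum T f (Suc (age A y)) ((T' ^^ age A y) y)"
      unfolding excursion_sum_def age_T[OF y False] funpow_T'_Suc_T[OF sp] ..
    then show ?thesis using False step by (simp add: return_sum_def)
  qed
qed

text \<open>The coboundary telescopes along the orbit, leaving only the two boundary terms.\<close>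

lemma birkhoff_sum_return_sum:
  assumes "x \<in> visited A"
  shows "birkhoff_sum T f n x =
    birkhoff_sum T (return_sum A f) n x + excursion_sum A f ((T ^^ n) x) - excursion_sum A f x"
proof (induction n)
  case (Suc n)
  show ?case
    using Suc return_sum_coboundary[OF visited_funpow[OF assms, of n], of f]
    by (simp add: birkhoff_sum_Suc)
qed simp

lemma excursion_sum_one: "excursion_sum A (\<lambda>_. 1) y = real (age A y)"
  by (simp add: excursion_sum_def birkhoff_sum_def)

lemma return_sum_one:
  "return_sum A (\<lambda>_. 1) y = (if y \<in> visited A \<and> T y \<in> A then real (Suc (age A y)) else 0)"
  by (simp add: return_sum_def birkhoff_sum_def)

section \<open>Measurability and integrability of return sums\<close>

lemma measurable_age [measurable]:
  assumes [measurable]: "A \<in> sets M"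
  shows "age A \<in> M \<rightarrow>\<^sub>M count_space UNIV"
  unfolding age_def by measurable

lemma measurable_visited [measurable]:
  assumes [measurable]: "A \<in> sets M"
  shows "visited A \<in> sets M"
  unfolding visited_def by measurable

lemma measurable_return_sum [measurable]:
  assumes [measurable]: "A \<in> sets M" "f \<in> borel_measurable M"
  shows "return_sum A f \<in> borel_measurable M"
proof -
  \<comment> \<open>The age takes countably many values, and for each fixed value the function is
    measurable.\<close>
  have [measurable]: "(\<lambda>y. birkhoff_sum T f (Suc (age A y)) ((T' ^^ age A y) y)) \<in> borel_measurable M"
    by (rule measurable_compose_countable[OF _ measurable_age[OF assms(1)]])
      (intro measurable_compose[OF measurable_compose_n[OF measurable_T']] birkhoff_sum_measurable assms)
  show ?thesis unfolding return_sum_def by measurable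
qed

text \<open>Kac: shifting back by \<open>t\<close> makes the level sets \<open>{t < return time}\<close> disjoint.\<close>

lemma integrable_return_sum_one:
  assumes [measurable]: "A \<in> sets M"
  shows "integrable M (return_sum A (\<lambda>_. 1))"
proof -
  \<comment> \<open>This is the length of the excursion, kept as a natural number so that its
    integral is the sum of the measures of the level sets \<open>L t\<close>.\<close>
  define r where "r y = (if y \<in> visited A \<and> T y \<in> A then Suc (age A y) else 0)" for y
  define L where "L t = {y \<in> space M. t < r y}" for t
  define D where "D t = (T ^^ t) -` L t \<inter> space M" for t
  have r [measurable]: "r \<in> M \<rightarrow>\<^sub>M count_space UNIV" unfolding r_def by measurable
  have L [measurable]: "L t \<in> sets M" for t unfolding L_def by measurable
  have D: "D t \<in> sets M" for t unfolding D_def by measurable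
  have "D s \<inter> D t = {}" if "t < s" for s t
  proof (rule ccontr)
    assume "D s \<inter> D t \<noteq> {}"
    then obtain z where z: "z \<in> space M" "s < r ((T ^^ s) z)" "t < r ((T ^^ t) z)"
      by (auto simp: D_def L_def)
    then have in_A: "(T ^^ Suc t) z \<in> A" and age: "s \<le> age A ((T ^^ s) z)"
      by (auto simp: r_def split: if_splits)
    \<comment> \<open>The orbit is in \<open>A\<close> at time \<open>t + 1\<close>, which is
      \<open>j\<close> steps before time \<open>s\<close>; yet the age at time \<open>s\<close> is
      at least \<open>s\<close>, and \<open>s > j\<close>.\<close>
    define j where "j = s - Suc t"
    have j: "s = j + Suc t" using that by (simp add: j_def)
    have "(T' ^^ j) ((T ^^ s) z) = (T ^^ Suc t) z"
      using funpow_T'_T[OF funpow_in_space[OF z(1)], of j "Suc t"] unfolding j funpow_add by simp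
    then have "age A ((T ^^ s) z) \<le> j" using in_A by (intro age_le) simp
    then show False using age j by simp
  qed
  then have disj: "disjoint_family D"
    unfolding disjoint_family_on_def by (metis Int_commute linorder_neqE_nat)
  have "(\<integral>\<^sup>+y. of_nat (r y) \<partial>M) = (\<Sum>t. emeasure M (L t))"
    using nn_integral_nat_function[OF r] by (simp add: L_def)
  also have "\<dots> = (\<Sum>t. emeasure M (D t))"
    by (simp add: D_def emeasure_funpow_vimage)
  also have "\<dots> = emeasure M (\<Union>t. D t)" using D disj by (intro suminf_emeasure) auto
  also have "\<dots> < \<infinity>" by (simp add: emeasure_eq_measure)
  finally have fin: "(\<integral>\<^sup>+y. of_nat (r y) \<partial>M) < \<infinity>" .
  have "return_sum A (\<lambda>_. 1) = (\<lambda>y. real (r y))"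
    by (auto simp: fun_eq_iff return_sum_one r_def)
  moreover have "integrable M (\<lambda>y. real (r y))"
    using fin by (intro integrableI_nonneg) (auto simp: ennreal_of_nat_eq_real_of_nat)
  ultimately show ?thesis by simp
qed

section \<open>Sublinear growth of the age and convergence of the averages\<close>

text \<open>For \<open>f = 1\<close> the telescoped identity expresses the age at time
  \<open>n\<close> as \<open>n\<close> minus the Birkhoff sum of the return time plus a constant, so
  age divided by \<open>n\<close> converges; the limit is nonnegative, and
  \<open>AE_frequently_le_linear\<close> rules out a positive one.\<close>

lemma AE_age_sublinear:
  assumes [measurable]: "A \<in> sets M"
  shows "AE x in M. x \<in> visited A \<longrightarrow> (\<lambda>n. real (age A ((T ^^ n) x)) / real n) \<longlonglongrightarrow> 0"
proof -
  \<comment> \<open>The countably many slopes \<open>1 / Suc k\<close> suffice, since one of them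
    lies below any given positive limit.\<close>
  have "AE x in M. \<forall>k::nat. \<exists>\<^sub>F n in sequentially.
      real (age A ((T ^^ n) x)) \<le> (1 / real (Suc k)) * real n"
    unfolding AE_all_countable by (intro allI AE_frequently_le_linear) auto
  with birkhoff_ergodic_convergent[OF integrable_return_sum_one[OF assms]]
  show ?thesis
  proof (eventually_elim, intro impI)
    fix x
    assume elim: "convergent (\<lambda>n. birkhoff_sum T (return_sum A (\<lambda>_. 1)) n x / real n)"
        "\<forall>k::nat. \<exists>\<^sub>F n in sequentially. real (age A ((T ^^ n) x)) \<le> (1 / real (Suc k)) * real n"
      and x: "x \<in> visited A"
    let ?P = "return_sum A (\<lambda>_. 1)"
    let ?p = "\<lambda>n. real (age A ((T ^^ n) x)) / real n"
    obtain l where l: "(\<lambda>n. birkhoff_sum T ?P n x / real n) \<longlonglongrightarrow> l"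
      using elim(1) by (auto simp: convergent_def)
    have "(\<lambda>n. 1 - birkhoff_sum T ?P n x / real n + real (age A x) / real n) \<longlonglongrightarrow> 1 - l + 0"
      by (intro tendsto_intros l lim_const_over_n)
    moreover have "eventually (\<lambda>n. 1 - birkhoff_sum T ?P n x / real n + real (age A x) / real n = ?p n)
        sequentially"
      using eventually_gt_at_top[of 0]
    proof eventually_elim
      case (elim n)
      have "real n = birkhoff_sum T ?P n x + real (age A ((T ^^ n) x)) - real (age A x)"
        using birkhoff_sum_return_sum[OF x, of "\<lambda>_. 1" n]
        by (simp add: excursion_sum_one birkhoff_sum_def)
      with elim show ?case by (simp add: field_simps)
    qed
    ultimately have lim: "?p \<longlonglongrightarrow> 1 - l" using tendsto_cong by fastforce
    have "0 \<le> 1 - l" by (rule LIMSEQ_le_const[OF lim]) auto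
    moreover have "1 - l \<le> 0"
    proof (rule ccontr)
      assume "\<not> 1 - l \<le> 0"
      then obtain k where k: "1 / real (Suc k) < 1 - l"
        using nat_approx_posE[of "1 - l"] by auto
      have "eventually (\<lambda>n. \<not> real (age A ((T ^^ n) x)) \<le> (1 / real (Suc k)) * real n) sequentially"
        using order_tendstoD(1)[OF lim k] eventually_gt_at_top[of 0]
        by eventually_elim (simp add: field_simps)
      with elim(2) show False by (auto simp: frequently_def)
    qed
    ultimately show "?p \<longlonglongrightarrow> 0" using lim by simp
  qed
qed

text \<open>Every excursion starts in \<open>A\<close>, so the bound there controls return sums by
  \<open>C\<close> times the return time, which is integrable, and excursion sums by
  \<open>C\<close> times the age, which is sublinear.\<close>

lemma AE_convergent_on_bounded_set:
  assumes A [measurable]: "A \<in> sets M" and f [measurable]: "f \<in> borel_measurable M"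
    and bound: "\<And>z n. z \<in> A \<Longrightarrow> \<bar>birkhoff_sum T f n z\<bar> \<le> C * real n"
  shows "AE x in M. x \<in> A \<longrightarrow> convergent (\<lambda>n. birkhoff_sum T f n x / real n)"
proof -
  have "integrable M (return_sum A f)"
  proof (rule Bochner_Integration.integrable_bound)
    show "integrable M (\<lambda>y. C * return_sum A (\<lambda>_. 1) y)"
      by (intro integrable_mult_right integrable_return_sum_one A)
    \<comment> \<open>Either \<open>y\<close> is about to return and the bound applies at its last
      visit to \<open>A\<close>, or both sides are 0.\<close>
    have "\<bar>return_sum A f y\<bar> \<le> C * return_sum A (\<lambda>_. 1) y" for y
      using bound[of "(T' ^^ age A y) y" "Suc (age A y)"] funpow_age_in[of y A]
      by (auto simp: return_sum_one return_sum_def)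
    then show "AE y in M. norm (return_sum A f y) \<le> norm (C * return_sum A (\<lambda>_. 1) y)"
      by (intro AE_I2) (metis abs_ge_self order_trans real_norm_def)
  qed measurable
  then have "AE x in M. convergent (\<lambda>n. birkhoff_sum T (return_sum A f) n x / real n)"
    by (rule birkhoff_ergodic_convergent)
  with AE_age_sublinear[OF A] AE_space show ?thesis
  proof (eventually_elim, intro impI)
    fix x
    assume elim: "x \<in> visited A \<longrightarrow> (\<lambda>n. real (age A ((T ^^ n) x)) / real n) \<longlonglongrightarrow> 0"
        "x \<in> space M" "convergent (\<lambda>n. birkhoff_sum T (return_sum A f) n x / real n)" "x \<in> A"
    have x: "x \<in> visited A" using elim by (auto simp: visited_def intro!: exI[of _ 0])
    obtain l where l: "(\<lambda>n. birkhoff_sum T (return_sum A f) n x / real n) \<longlonglongrightarrow> l"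
      using elim by (auto simp: convergent_def)
    have "(\<lambda>n. C * (real (age A ((T ^^ n) x)) / real n)) \<longlonglongrightarrow> 0"
      using elim(1) x by (intro tendsto_mult_right_zero) auto
    then have "(\<lambda>n. excursion_sum A f ((T ^^ n) x) / real n) \<longlonglongrightarrow> 0"
    proof (rule Lim_null_comparison[rotated], intro always_eventually allI)
      fix n
      have "\<bar>excursion_sum A f ((T ^^ n) x)\<bar> \<le> C * real (age A ((T ^^ n) x))"
        unfolding excursion_sum_def by (intro bound funpow_age_in visited_funpow x)
      then show "norm (excursion_sum A f ((T ^^ n) x) / real n) \<le> C * (real (age A ((T ^^ n) x)) / real n)"
        by (simp add: divide_right_mono)
    qed
    then have "(\<lambda>n. birkhoff_sum T (return_sum A f) n x / real n
        + excursion_sum A f ((T ^^ n) x) / real n - excursion_sum A f x / real n) \<longlonglongrightarrow> l + 0 - 0"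
      by (intro tendsto_intros l lim_const_over_n)
    moreover have "birkhoff_sum T f n x / real n = birkhoff_sum T (return_sum A f) n x / real n
        + excursion_sum A f ((T ^^ n) x) / real n - excursion_sum A f x / real n" for n
      by (subst birkhoff_sum_return_sum[OF x]) (simp add: add_divide_distrib diff_divide_distrib)
    ultimately show "convergent (\<lambda>n. birkhoff_sum T f n x / real n)"
      unfolding convergent_def by auto
  qed
qed

text \<open>A finite value of the maximal function lies below some natural number \<open>C\<close>,
  so the countably many sets \<open>A C\<close> cover almost all of the space.\<close>

theorem AE_convergent_of_finite_maximal:
  assumes f [measurable]: "f \<in> borel_measurable M"
    and fin: "AE x in M. ergodic_maximal T f x < \<infinity>"
  shows "AE x in M. convergent (\<lambda>n. birkhoff_sum T f n x / real n)"
proof -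
  define A where "A C = {x \<in> space M. \<forall>n. \<bar>birkhoff_sum T f n x\<bar> \<le> real C * real n}" for C :: nat
  have A: "A C \<in> sets M" for C unfolding A_def by measurable
  have "AE x in M. \<forall>C. x \<in> A C \<longrightarrow> convergent (\<lambda>n. birkhoff_sum T f n x / real n)"
    unfolding AE_all_countable
  proof
    show "AE x in M. x \<in> A C \<longrightarrow> convergent (\<lambda>n. birkhoff_sum T f n x / real n)" for C
      by (rule AE_convergent_on_bounded_set[OF A f, of C "real C"]) (simp add: A_def)
  qed
  with fin AE_space show ?thesis
  proof eventually_elim
    case (elim x)
    obtain C :: nat where C: "ergodic_maximal T f x < ereal (real C)"
      using less_PInf_Ex_of_nat[of "ergodic_maximal T f x"] elim(1) by auto
    \<comment> \<open>The supremum starts at \<open>n = 1\<close>; at \<open>n = 0\<close> both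
      sides vanish.\<close>
    have "\<bar>birkhoff_sum T f n x\<bar> \<le> real C * real n" for n
    proof (cases "n = 0")
      case False
      have "ereal ((1 / real n) * \<bar>\<Sum>k<n. f ((T ^^ k) x)\<bar>) \<le> ergodic_maximal T f x"
        unfolding ergodic_maximal_def using False by (intro SUP_upper) simp
      then have "ereal ((1 / real n) * \<bar>birkhoff_sum T f n x\<bar>) \<le> ereal (real C)"
        using C unfolding birkhoff_sum_def by (metis less_imp_le order_trans)
      then show ?thesis using False by (simp add: field_simps)
    qed simp
    then show ?case using elim by (auto simp: A_def)
  qed
qed

end

theorem theorem2:
  fixes M :: "'a measure" and T :: "'a \<Rightarrow> 'a" and f :: "'a \<Rightarrow> real"
  assumes "standard_probability_space M"
    and "invertible_measure_preserving M T"
    and "f \<in> borel_measurable (completion M)"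
    and "AE x in M. ergodic_maximal T f x < \<infinity>"
  shows "AE x in M. convergent (\<lambda>n. ergodic_average T f n x)"
proof -
  interpret prob_space M using assms(1) by (simp add: standard_probability_space_def)
  have bij: "bij_betw T (space M) (space M)"
    and T: "T \<in> M \<rightarrow>\<^sub>M M"
    and T': "inv_into (space M) T \<in> M \<rightarrow>\<^sub>M M"
    and pres: "\<And>A. A \<in> sets M \<Longrightarrow> emeasure M (T -` A \<inter> space M) = emeasure M A"
    using assms(2) by (auto simp: invertible_measure_preserving_def)
  have "distr M M T = M"
    using T pres by (intro measure_eqI) (auto simp: emeasure_distr)
  with T T' bij interpret invertible_prob_preserving M T "inv_into (space M) T"
    by unfold_locales
      (auto simp: bij_betw_inv_into_left bij_betw_inv_into_right)
  \<comment> \<open>As \<open>f\<close> is measurable for the completion, it is replaced by a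
    function \<open>g\<close> that is measurable for \<open>M\<close> itself.\<close>
  obtain g where g: "g \<in> borel_measurable M" and fg: "AE x in M. f x = g x"
    using completion_ex_borel_measurable_real[OF assms(3)] by blast
  \<comment> \<open>Iterates of \<open>T\<close> pull null sets back to null sets, so
    \<open>f\<close> and \<open>g\<close> agree along the whole orbit of almost every point; their
    sums and maximal functions then agree there as well.\<close>
  have "AE x in M. \<forall>k. f ((T ^^ k) x) = g ((T ^^ k) x)"
    unfolding AE_all_countable by (intro allI AE_funpow fg)
  then have sums: "AE x in M. \<forall>n. birkhoff_sum T f n x = birkhoff_sum T g n x"
    by eventually_elim (simp add: birkhoff_sum_def)
  have "AE x in M. ergodic_maximal T g x < \<infinity>"
    using sums assms(4)
    by eventually_elim (simp add: ergodic_maximal_def birkhoff_sum_def)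
  then have "AE x in M. convergent (\<lambda>n. birkhoff_sum T g n x / real n)"
    by (rule AE_convergent_of_finite_maximal[OF g])
  with sums show ?thesis
    by eventually_elim (simp add: ergodic_average_eq)
qed

end
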